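(* Let $q$ be a prime power and $n,m\ge 2$ integers with $n\le m$. Then $$\chi(\mathscr{L}_{n-1}(n,m;q);\lambda)=\Big(\lambda-q^{(n-1)m}+\prod_{s=1}^{n-1}(q^m-q^s)\Big)\prod_{j=0}^{n-2}(\lambda-q^{mj}).$$
   Context: The rank $\mathrm{rk}(v)$ of $v\in\mathbb{F}_{q^m}^n$ is the $\mathbb{F}_q$-dimension of the $\mathbb{F}_q$-span of its entries. For $i\in\{1,\dots,n\}$, $\mathscr{L}_i(n,m;q)$ is the set of $\mathbb{F}_{q^m}$-linear subspaces of $\mathbb{F}_{q^m}^n$ spanned by vectors of rank at most $i$ (including $\{0\}$), ordered by inclusion; it is a geometric lattice of rank $n$ with rank function $\dim_{\mathbb{F}_{q^m}}$. For a finite graded lattice $\mathscr{L}$ with minimum $0$, rank function $\rho$ and Möbius function $\mu$, the characteristic polynomial is $\chi(\mathscr{L};\lambda)=\sum_{X\in\mathscr{L}}\mu(0,X)\lambda^{\rho(1_{\mathscr{L}})-\rho(X)}$. *)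

theory Defs
  imports
    "HOL-Analysis.Cartesian_Space"
    "HOL-Computational_Algebra.Polynomial"
    "HOL-Number_Theory.Prime_Powers"
begin

function mobius :: "'b::order set \<Rightarrow> 'b \<Rightarrow> 'b \<Rightarrow> int" where
  "mobius P x y =
    (if \<not> finite P then 0
     else if x = y then 1
     else if x < y then - (\<Sum>z \<in> {z \<in> P. x \<le> z \<and> z < y}. mobius P x z)
     else 0)"
  by pat_completeness auto
termination
proof (relation "measure (\<lambda>(P, x, y). card {z \<in> P. z < y})", goal_cases)
  case (2 P x y z)
  then have "{w \<in> P. w < z} \<subset> {w \<in> P. w < y}"
    by (auto dest: less_trans)
  with 2 show ?case
    by (simp add: psubset_card_mono)
qed simp

declare mobius.simps [simp del]

text \<open>
  The height of \<open>x\<close> in a finite poset \<open>P\<close>: the length of a longest chain in \<open>P\<close> lying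
  below \<open>x\<close>. In a graded poset with a minimum this is the rank function.
\<close>

definition poset_rank :: "'b::order set \<Rightarrow> 'b \<Rightarrow> nat" where
  "poset_rank P x =
    Max {card C - 1 | C. C \<subseteq> {y \<in> P. y \<le> x} \<and> Complete_Partial_Order.chain (\<le>) C}"

definition characteristic_poly :: "'b::order set \<Rightarrow> int poly" where
  "characteristic_poly P =
    (\<Sum>x\<in>P. monom (mobius P (LEAST y. y \<in> P) x)
                (poset_rank P (GREATEST y. y \<in> P) - poset_rank P x))"

text \<open>
  The extension of finite fields is given by two field types and an embedding of the small
  field into the large one; injectivity is automatic.
\<close>

definition field_embedding :: "('k::field \<Rightarrow> 'a::field) \<Rightarrow> bool" where
  "field_embedding h \<longleftrightarrow>
    h 1 = 1 \<and> (\<forall>x y. h (x + y) = h x + h y) \<and> (\<forall>x y. h (x * y) = h x * h y)"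

definition ext_scale :: "('k::field \<Rightarrow> 'a::field) \<Rightarrow> 'k \<Rightarrow> 'a \<Rightarrow> 'a" where
  "ext_scale h c x = h c * x"

lemma vector_space_ext_scale:
  assumes "field_embedding h"
  shows "vector_space (ext_scale h)"
  using assms
  by unfold_locales (auto simp: field_embedding_def ext_scale_def algebra_simps)

definition rk :: "('k::field \<Rightarrow> 'a::field) \<Rightarrow> 'a ^ 'n \<Rightarrow> nat" where
  "rk h v = vector_space.dim (ext_scale h) (module.span (ext_scale h) (range (\<lambda>i. v $ i)))"

definition rank_lattice :: "('k::field \<Rightarrow> 'a::field) \<Rightarrow> nat \<Rightarrow> ('a ^ 'n) set set" where
  "rank_lattice h i = {vec.span S | S. \<forall>v\<in>S. rk h v \<le> i}"

end

theory Submission imports Defs "HOL-Library.FuncSet"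
begin

text \<open>
  Let \<open>Q = q ^ m\<close>. By the critical theorem, the value of the characteristic polynomial at
  \<open>Q ^ k\<close> is the number of linear maps from the ambient space to a \<open>k\<close>-dimensional space whose
  kernel contains no nonzero vector of rank less than \<open>n\<close>. A vector with a vanishing coordinate
  has rank less than \<open>n\<close>, so such a kernel has dimension at most 1. Hence there are no such maps
  for \<open>k < n - 1\<close>, and for \<open>k = n - 1\<close> the kernels are exactly the lines spanned by the vectors
  of rank \<open>n\<close>, which are the \<open>n\<close>-tuples of elements of the large field that are independent over
  the small one. These \<open>n\<close> values determine the monic polynomial of degree \<open>n\<close>.
\<close>

section \<open>Spans and independent families over a finite field\<close>

text \<open>For \<open>b\<close> outside \<open>span B\<close>, each element of the enlarged span is
  uniquely \<open>scale c b + x\<close> with \<open>x\<close> in \<open>span B\<close>, so every new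
  basis vector multiplies the size by the order of the field.\<close>

lemma (in vector_space) card_span_independent:
  assumes "finite (UNIV :: 'a set)" and "finite B" and "independent B"
  shows "finite (span B) \<and> card (span B) = CARD('a) ^ card B"
  using assms(2,3)
proof (induction B rule: finite_induct)
  case empty
  then show ?case by simp
next
  case (insert b B)
  then have B: "independent B" "b \<notin> span B"
    by (auto simp: independent_insert)
  have "bij_betw (\<lambda>(c, x). scale c b + x) (UNIV \<times> span B) (span (insert b B))"
  proof (rule bij_betw_imageI)
    show "inj_on (\<lambda>(c, x). scale c b + x) (UNIV \<times> span B)"
    proof (rule inj_onI, clarify)
      fix c x d y
      assume xy: "x \<in> span B" "y \<in> span B" and eq: "scale c b + x = scale d b + y"
      have "scale (c - d) b = y - x"
        using eq by (simp add: scale_left_diff_distrib algebra_simps)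
      then have "scale (c - d) b \<in> span B"
        using xy by (simp add: span_diff)
      \<comment> \<open>For \<open>c\<close> different from \<open>d\<close> this vector is
        \<open>b\<close> itself, which lies outside \<open>span B\<close>.\<close>
      then have "scale (inverse (c - d)) (scale (c - d) b) \<in> span B"
        by (rule span_scale)
      then have "c = d"
        using B(2) by (cases "c = d") auto
      then show "c = d \<and> x = y"
        using eq by simp
    qed
    show "(\<lambda>(c, x). scale c b + x) ` (UNIV \<times> span B) = span (insert b B)"
    proof (intro set_eqI iffI)
      fix y assume "y \<in> span (insert b B)"
      then obtain k where "y - scale k b \<in> span B"
        by (auto simp: span_breakdown_eq)
      then show "y \<in> (\<lambda>(c, x). scale c b + x) ` (UNIV \<times> span B)"
        by (intro image_eqI[of _ _ "(k, y - scale k b)"]) auto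
    qed (auto intro!: span_add span_scale intro: span_base span_mono[THEN subsetD])
  qed
  from bij_betw_finite[OF this] bij_betw_same_card[OF this] show ?case
    using insert B assms(1) by (auto simp: card_cartesian_product finite_cartesian_product_iff)
qed

text \<open>These are independent tuples indexed by \<open>I\<close>. Injectivity is a separate
  condition because independence of the image set does not detect repeated entries.\<close>

definition (in vector_space) indep_families :: "'i set \<Rightarrow> 'b set \<Rightarrow> ('i \<Rightarrow> 'b) set" where
  "indep_families I S = {g \<in> I \<rightarrow>\<^sub>E S. inj_on g I \<and> independent (g ` I)}"

text \<open>A family on \<open>I\<close> extends to a new index by exactly the vectors of
  \<open>S\<close> outside its span. That span lies in \<open>S\<close> and its size depends on
  \<open>card I\<close> alone, so each index contributes one factor.\<close>

lemma (in vector_space) card_indep_families: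
  fixes I :: "'i set"
  assumes "finite (UNIV :: 'a set)" and "finite I" and "finite S" and "subspace S"
  shows "int (card (indep_families I S)) =
    (\<Prod>j<card I. int (card S) - int (CARD('a) ^ j))"
  using assms(2)
proof (induction I rule: finite_induct)
  case empty
  have "indep_families ({} :: 'i set) S = {\<lambda>x. undefined}"
    by (auto simp: indep_families_def independent_empty)
  then show ?case by simp
next
  case (insert i I)
  let ?\<Sigma> = "SIGMA g : indep_families I S. S - span (g ` I)"
  have "bij_betw (\<lambda>(g, y). g(i := y)) ?\<Sigma> (indep_families (insert i I) S)"
  proof (rule bij_betw_byWitness[where f' = "\<lambda>g. (restrict g I, g i)"])
    show "\<forall>a\<in>?\<Sigma>. (\<lambda>g. (restrict g I, g i)) ((\<lambda>(g, y). g(i := y)) a) = a"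
      using insert.hyps by (auto simp: indep_families_def restrict_def PiE_def extensional_def)
    show "\<forall>g\<in>indep_families (insert i I) S. (\<lambda>(g, y). g(i := y)) (restrict g I, g i) = g"
      by (auto simp: indep_families_def restrict_def PiE_def extensional_def)
    show "(\<lambda>(g, y). g(i := y)) ` ?\<Sigma> \<subseteq> indep_families (insert i I) S"
    proof (clarify)
      fix g y assume g: "g \<in> indep_families I S" and y: "y \<in> S" "y \<notin> span (g ` I)"
      have upd: "(g(i := y)) ` I = g ` I"
        using insert.hyps by auto
      have "y \<notin> g ` I"
        using y span_base by blast
      then have "inj_on (g(i := y)) (insert i I)"
        using g insert.hyps unfolding indep_families_def by (auto simp: inj_on_def)
      then show "g(i := y) \<in> indep_families (insert i I) S"
        using g y upd independent_insertI[OF y(2)]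
        by (auto simp: indep_families_def PiE_def extensional_def Pi_def)
    qed
    show "(\<lambda>g. (restrict g I, g i)) ` indep_families (insert i I) S \<subseteq> ?\<Sigma>"
    proof (rule image_subsetI)
      fix g assume g: "g \<in> indep_families (insert i I) S"
      have "g i \<notin> g ` I"
        using g insert.hyps unfolding indep_families_def by (auto simp: inj_on_def)
      then have "independent (g ` I)" "g i \<notin> span (g ` I)"
        using g by (auto simp: indep_families_def independent_insert)
      then show "(restrict g I, g i) \<in> ?\<Sigma>"
        using g by (auto simp: indep_families_def PiE_def Pi_def inj_on_def)
    qed
  qed
  then have "card (indep_families (insert i I) S) = card ?\<Sigma>"
    by (simp add: bij_betw_same_card)
  also have "\<dots> = (\<Sum>g \<in> indep_families I S. card (S - span (g ` I)))"
    using insert.hyps assms(3)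
    by (intro card_SigmaI) (auto simp: indep_families_def intro!: finite_subset[OF _ finite_PiE[of I "\<lambda>_. S"]])
  finally have "int (card (indep_families (insert i I) S)) =
      (\<Sum>g \<in> indep_families I S. int (card (S - span (g ` I))))"
    by simp
  also have "\<dots> = (\<Sum>g \<in> indep_families I S. int (card S) - int (CARD('a) ^ card I))"
  proof (rule sum.cong)
    fix g assume g: "g \<in> indep_families I S"
    then have "span (g ` I) \<subseteq> S"
      using assms(4) by (intro span_minimal) (auto simp: indep_families_def)
    moreover have "card (span (g ` I)) = CARD('a) ^ card I"
      using g card_span_independent[OF assms(1), of "g ` I"] insert.hyps
      by (auto simp: indep_families_def card_image)
    ultimately show "int (card (S - span (g ` I))) = int (card S) - int (CARD('a) ^ card I)"
      using assms(3) by (metis card_Diff_subset card_mono finite_subset of_nat_diff)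
  qed simp
  finally show ?case
    using insert by simp
qed

section \<open>Linear maps into a subspace, counted by their kernels\<close>

text \<open>A subspace \<open>U\<close> of the ambient space plays the role of the
  \<open>k\<close>-dimensional target, so that all \<open>k\<close> up to \<open>n\<close> are
  treated within one type.\<close>

definition homs_into :: "('a::field ^ 'n) set \<Rightarrow> ('a ^ 'n \<Rightarrow> 'a ^ 'n) set" where
  "homs_into U = {f. Vector_Spaces.linear (*s) (*s) f \<and> range f \<subseteq> U}"

text \<open>A linear map is determined by its values on the basis \<open>B \<union> C\<close>, and
  these can be prescribed freely; zero on \<open>B\<close> leaves the values on \<open>C\<close> to
  choose.\<close>

lemma homs_into_restrict_bij:
  fixes B C U :: "('a::field ^ 'n) set"
  assumes indep: "vec.independent (B \<union> C)" and span: "vec.span (B \<union> C) = UNIV"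
    and disj: "B \<inter> C = {}" and U: "vec.subspace U"
  shows "bij_betw (\<lambda>f. restrict f C) {f \<in> homs_into U. \<forall>b\<in>B. f b = 0} (C \<rightarrow>\<^sub>E U)"
proof (rule bij_betw_imageI)
  show "inj_on (\<lambda>f. restrict f C) {f \<in> homs_into U. \<forall>b\<in>B. f b = 0}"
  proof (rule inj_onI)
    fix f g
    assume f: "f \<in> {f \<in> homs_into U. \<forall>b\<in>B. f b = 0}"
      and g: "g \<in> {f \<in> homs_into U. \<forall>b\<in>B. f b = 0}"
      and eq: "restrict f C = restrict g C"
    have "f b = g b" if "b \<in> B \<union> C" for b
      using that f g fun_cong[OF eq, of b] by (auto simp: restrict_def split: if_splits)
    moreover have "Vector_Spaces.linear (*s) (*s) f" "Vector_Spaces.linear (*s) (*s) g"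
      using f g by (simp_all add: homs_into_def)
    ultimately show "f = g"
      using vec.linear_eq_on[of f g _ "B \<union> C"] span by (metis UNIV_I ext)
  qed
  show "(\<lambda>f. restrict f C) ` {f \<in> homs_into U. \<forall>b\<in>B. f b = 0} = (C \<rightarrow>\<^sub>E U)"
  proof (intro set_eqI iffI)
    fix g assume g: "g \<in> C \<rightarrow>\<^sub>E U"
    define g' where "g' b = (if b \<in> C then g b else 0)" for b
    \<comment> \<open>The extension is taken with range spanned by the prescribed values, which
      keeps it inside \<open>U\<close>.\<close>
    obtain f where f: "Vector_Spaces.linear (*s) (*s) f" "\<forall>b\<in>B \<union> C. f b = g' b"
        "range f = vec.span (g' ` (B \<union> C))"
      using vec.linear_independent_extend_subspace[OF indep, of g'] by auto
    have "g' ` (B \<union> C) \<subseteq> U"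
      using g U by (auto simp: g'_def vec.subspace_0)
    then have "f \<in> homs_into U"
      using f U by (simp add: homs_into_def vec.span_minimal)
    moreover have "\<forall>b\<in>B. f b = 0"
      using f(2) disj by (auto simp: g'_def)
    moreover have "g = restrict f C"
      using g f(2) by (auto simp: g'_def restrict_def fun_eq_iff PiE_def extensional_def)
    ultimately show "g \<in> (\<lambda>f. restrict f C) ` {f \<in> homs_into U. \<forall>b\<in>B. f b = 0}"
      by blast
  qed (auto simp: homs_into_def)
qed

lemma extend_to_basis:
  fixes B :: "('a::field ^ 'n) set"
  assumes "vec.independent B"
  obtains C where "vec.independent (B \<union> C)" "vec.span (B \<union> C) = UNIV" "B \<inter> C = {}" "finite C"
    "card C = CARD('n) - card B"
proof -
  obtain D where D: "B \<subseteq> D" "vec.independent D" "UNIV \<subseteq> vec.span D"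
    by (rule vec.maximal_independent_subset_extend[OF subset_UNIV assms])
  have "card D = CARD('n)"
    using vec.basis_card_eq_dim[of D UNIV] D by (simp add: card_cart_basis)
  moreover have "finite D"
    using D vec.finiteI_independent by blast
  moreover have "B \<union> (D - B) = D"
    using D by blast
  ultimately show ?thesis
    using D by (intro that[of "D - B"]) (auto simp: card_Diff_subset finite_subset)
qed

lemma homs_into_linear:
  assumes "f \<in> homs_into U"
  shows "Vector_Spaces.linear (*s) (*s) f"
  using assms by (simp add: homs_into_def)

text \<open>Extending a basis of \<open>X\<close> to one of the whole space adds
  \<open>CARD('n) - vec.dim X\<close> vectors, and their images in \<open>U\<close> are
  arbitrary.\<close>

lemma card_homs_into_vanishing:
  fixes X U :: "('a::{field,finite} ^ 'n) set"
  assumes X: "vec.subspace X" and U: "vec.subspace U"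
  shows "card {f \<in> homs_into U. \<forall>x\<in>X. f x = 0} = card U ^ (CARD('n) - vec.dim X)"
proof -
  obtain B where B: "B \<subseteq> X" "vec.independent B" "X \<subseteq> vec.span B" "card B = vec.dim X"
    using vec.basis_exists by blast
  have spB: "vec.span B = X"
    using B X by (meson subset_antisym vec.span_minimal)
  obtain C where C: "vec.independent (B \<union> C)" "vec.span (B \<union> C) = UNIV" "B \<inter> C = {}" "finite C"
      "card C = CARD('n) - card B"
    using extend_to_basis[OF B(2)] .
  have "f x = 0" if f: "f \<in> homs_into U" "\<forall>b\<in>B. f b = 0" and x: "x \<in> X" for f x
  proof (rule vec.linear_eq_0_on_span[of f B])
    show "Vector_Spaces.linear (*s) (*s) f"
      using f by (simp add: homs_into_linear)
  qed (use f x spB in auto)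
  then have "{f \<in> homs_into U. \<forall>x\<in>X. f x = 0} = {f \<in> homs_into U. \<forall>b\<in>B. f b = 0}"
    using B by blast
  then show ?thesis
    using bij_betw_same_card[OF homs_into_restrict_bij[OF C(1-3) U]] C B
    by (simp add: card_PiE)
qed

text \<open>The line of \<open>v\<close> and \<open>vec.span C\<close> are complementary. Modulo
  multiples of \<open>v\<close> every kernel element lies in \<open>vec.span C\<close>, so the
  kernel is exactly the line when \<open>f\<close> is injective on that complement.\<close>

lemma kernel_eq_span_singleton_iff:
  fixes f :: "'a::field ^ 'n \<Rightarrow> 'a ^ 'n"
  assumes indep: "vec.independent ({v} \<union> C)" and span: "vec.span ({v} \<union> C) = UNIV"
    and disj: "v \<notin> C"
    and f: "Vector_Spaces.linear (*s) (*s) f" and v: "f v = 0"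
  shows "{x. f x = 0} = vec.span {v} \<longleftrightarrow> inj_on f C \<and> vec.independent (f ` C)"
proof -
  interpret f: Vector_Spaces.linear "(*s)" "(*s)" f by fact
  have C: "vec.independent C" "v \<notin> vec.span C"
    using indep disj by (auto simp: vec.independent_insert)
  show ?thesis
  proof
    assume ker: "{x. f x = 0} = vec.span {v}"
    have "inj_on f (vec.span C)"
    proof (rule inj_onI)
      fix x y assume xy: "x \<in> vec.span C" "y \<in> vec.span C" "f x = f y"
      then have "f (x - y) = 0"
        by (simp add: f.diff)
      then have "x - y \<in> vec.span {v}"
        using ker by blast
      then obtain c where c: "x - y = c *s v"
        by (auto simp: vec.span_singleton)
      have "c = 0"
      proof (rule ccontr)
        assume "c \<noteq> 0"
        then have "v = inverse c *s (x - y)"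
          by (simp add: c vec.scale_scale)
        then have "v \<in> vec.span C"
          using xy by (metis vec.span_diff vec.span_scale)
        then show False
          using C by blast
      qed
      then show "x = y"
        using c by simp
    qed
    then show "inj_on f C \<and> vec.independent (f ` C)"
      using C f vec.linear_independent_injective_image[OF f C(1)]
      by (meson inj_on_subset vec.span_superset)
  next
    assume fC: "inj_on f C \<and> vec.independent (f ` C)"
    have "x \<in> vec.span {v}" if "f x = 0" for x
    proof -
      have "x \<in> vec.span (insert v C)"
        using span by simp
      then obtain k where k: "x - k *s v \<in> vec.span C"
        by (auto simp: vec.span_breakdown_eq)
      have "f (x - k *s v) = 0"
        by (simp add: f.diff f.scale that v)
      then have "x - k *s v = 0"
        using k fC C vec.finiteI_independent vec.linear_indep_image_lemma[OF f, of C] by blast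
      then show ?thesis
        by (auto simp: vec.span_singleton)
    qed
    moreover have "f x = 0" if "x \<in> vec.span {v}" for x
      using that by (auto simp: vec.span_singleton f.scale v)
    ultimately show "{x. f x = 0} = vec.span {v}"
      by blast
  qed
qed

text \<open>After completing \<open>v\<close> to a basis by \<open>C\<close>, such maps correspond
  to independent families in \<open>U\<close> indexed by the \<open>CARD('n) - 1\<close> elements of
  \<open>C\<close>.\<close>

lemma card_homs_into_kernel_line:
  fixes v :: "'a::{field,finite} ^ 'n" and U :: "('a ^ 'n) set"
  assumes v: "v \<noteq> 0" and U: "vec.subspace U"
  shows "int (card {f \<in> homs_into U. {x. f x = 0} = vec.span {v}}) =
    (\<Prod>j<CARD('n) - 1. int (card U) - int (CARD('a) ^ j))"
proof -
  obtain C where C: "vec.independent ({v} \<union> C)" "vec.span ({v} \<union> C) = UNIV" "{v} \<inter> C = {}" "finite C"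
      "card C = CARD('n) - card {v}"
    using extend_to_basis[of "{v}"] v by auto
  let ?A = "{f \<in> homs_into U. \<forall>b\<in>{v}. f b = 0}"
  have *: "{x. f x = 0} = vec.span {v} \<longleftrightarrow> restrict f C \<in> vec.indep_families C U" if "f \<in> ?A" for f
  proof -
    have "restrict f C \<in> C \<rightarrow>\<^sub>E U"
      using that by (auto simp: homs_into_def)
    then show ?thesis
      using kernel_eq_span_singleton_iff[OF C(1,2) _ homs_into_linear[of f U]] that C(3)
      by (simp add: vec.indep_families_def inj_on_restrict_eq)
  qed
  have sets: "{f \<in> homs_into U. {x. f x = 0} = vec.span {v}} = {f \<in> ?A. restrict f C \<in> vec.indep_families C U}"
    using * vec.span_base[of v "{v}"] by auto
  have bij_indep: "bij_betw (\<lambda>f. restrict f C) {f \<in> ?A. restrict f C \<in> vec.indep_families C U}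
      (vec.indep_families C U)"
  proof -
    have bij: "bij_betw (\<lambda>f. restrict f C) ?A (C \<rightarrow>\<^sub>E U)"
      by (rule homs_into_restrict_bij[OF C(1-3) U])
    have "(\<lambda>f. restrict f C) ` {f \<in> ?A. restrict f C \<in> vec.indep_families C U}
        = (C \<rightarrow>\<^sub>E U) \<inter> vec.indep_families C U"
      unfolding bij_betw_imp_surj_on[OF bij, symmetric] by blast
    also have "\<dots> = vec.indep_families C U"
      by (auto simp: vec.indep_families_def)
    finally show ?thesis
      by (rule bij_betw_subset[OF bij, rotated]) (rule Collect_restrict)
  qed
  have eq: "card {f \<in> homs_into U. {x. f x = 0} = vec.span {v}} = card (vec.indep_families C U)"
    unfolding sets using bij_indep by (rule bij_betw_same_card)
  show ?thesis
    unfolding eq using vec.card_indep_families[OF finite C(4) finite U] C(5) by simp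
qed

section \<open>Moebius function, rank and characteristic polynomial of a lattice of spans\<close>

lemma sum_mobius:
  fixes P :: "'b::order set"
  assumes P: "finite P" and xy: "x \<in> P" "y \<in> P" "x \<le> y"
  shows "(\<Sum>z | z \<in> P \<and> x \<le> z \<and> z \<le> y. mobius P x z) = (if x = y then 1 else 0)"
proof (cases "x = y")
  case True
  then have "{z \<in> P. x \<le> z \<and> z \<le> y} = {x}"
    using xy by auto
  then show ?thesis
    using True P by (simp add: mobius.simps)
next
  case False
  have "{z \<in> P. x \<le> z \<and> z \<le> y} = insert y {z \<in> P. x \<le> z \<and> z < y}"
    using xy by auto
  then have "(\<Sum>z | z \<in> P \<and> x \<le> z \<and> z \<le> y. mobius P x z)
      = mobius P x y + (\<Sum>z | z \<in> P \<and> x \<le> z \<and> z < y. mobius P x z)"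
    using P by simp
  also have "mobius P x y = - (\<Sum>z | z \<in> P \<and> x \<le> z \<and> z < y. mobius P x z)"
    using False P xy by (subst mobius.simps) auto
  finally show ?thesis
    using False by simp
qed

text \<open>This is the lattice of flats of the vector matroid on \<open>A\<close>, with each flat
  replaced by its span; \<open>rank_lattice\<close> is the case where \<open>A\<close> is given by a
  bound on the rank.\<close>

definition span_lattice :: "('a::field ^ 'n) set \<Rightarrow> ('a ^ 'n) set set" where
  "span_lattice A = {vec.span S | S. S \<subseteq> A}"

text \<open>Adding the vectors of \<open>B\<close> one at a time gives a strictly increasing flag of
  spans.\<close>

lemma span_lattice_chain_exists:
  fixes B :: "('a::field ^ 'n) set"
  assumes "finite B" and "vec.independent B" and "B \<subseteq> A"
  shows "\<exists>C. C \<subseteq> {Y \<in> span_lattice A. Y \<le> vec.span B} \<and> Complete_Partial_Order.chain (\<le>) C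
    \<and> finite C \<and> card C = card B + 1"
  using assms
proof (induction B rule: finite_induct)
  case empty
  show ?case
    by (intro exI[of _ "{vec.span {}}"]) (auto simp: span_lattice_def chain_def intro!: exI[of _ "{}"])
next
  case (insert b B)
  then have b: "vec.independent B" "b \<notin> vec.span B"
    by (auto simp: vec.independent_insert)
  obtain C where C: "C \<subseteq> {Y \<in> span_lattice A. Y \<le> vec.span B}" "Complete_Partial_Order.chain (\<le>) C"
      "finite C" "card C = card B + 1"
    using insert b by auto
  have le: "vec.span B \<le> vec.span (insert b B)"
    by (intro vec.span_mono) auto
  have new: "vec.span (insert b B) \<notin> C"
    using C(1) b(2) vec.span_base[of b "insert b B"] by auto
  have "vec.span (insert b B) \<in> span_lattice A"
    using insert.prems by (auto simp: span_lattice_def)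
  moreover have "Complete_Partial_Order.chain (\<le>) (insert (vec.span (insert b B)) C)"
  proof -
    have "Y \<le> vec.span (insert b B)" if "Y \<in> C" for Y
      using that C(1) le by blast
    then show ?thesis
      using C(2) unfolding chain_def by blast
  qed
  ultimately show ?case
    using C le new insert.hyps
    by (intro exI[of _ "insert (vec.span (insert b B)) C"]) auto
qed

text \<open>A flag attains the dimension. No chain is longer, because nested subspaces of equal
  dimension coincide, so \<open>vec.dim\<close> is injective on a chain.\<close>

lemma poset_rank_span_lattice:
  fixes A :: "('a::{field,finite} ^ 'n) set"
  assumes "X \<in> span_lattice A"
  shows "poset_rank (span_lattice A) X = vec.dim X"
proof -
  obtain S where S: "S \<subseteq> A" "X = vec.span S"
    using assms by (auto simp: span_lattice_def)
  \<comment> \<open>The basis is chosen among the generators, so that all members of its flag stay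
    in the lattice.\<close>
  obtain B where B: "B \<subseteq> S" "vec.independent B" "S \<subseteq> vec.span B" "card B = vec.dim S"
    using vec.basis_exists by blast
  have spB: "vec.span B = X"
    using B S by (metis subset_antisym vec.span_minimal vec.span_mono vec.subspace_span)
  obtain C where C: "C \<subseteq> {Y \<in> span_lattice A. Y \<le> X}" "Complete_Partial_Order.chain (\<le>) C"
      "card C = vec.dim X + 1"
    using span_lattice_chain_exists[of B A] B S spB by auto
  have upper: "card D \<le> vec.dim X + 1"
    if D: "D \<subseteq> {Y \<in> span_lattice A. Y \<le> X}" "Complete_Partial_Order.chain (\<le>) D" for D
  proof -
    have "inj_on vec.dim D"
    proof (rule inj_onI)
      fix Y Z assume YZ: "Y \<in> D" "Z \<in> D" "vec.dim Y = vec.dim Z"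
      have sub: "vec.subspace Y" "vec.subspace Z"
        using D(1) YZ by (auto simp: span_lattice_def)
      have "Y \<subseteq> Z \<or> Z \<subseteq> Y"
        using D(2) YZ by (auto simp: chain_def)
      then show "Y = Z"
        using vec.subspace_dim_equal sub YZ(3) by (metis order_refl)
    qed
    moreover have "vec.dim ` D \<subseteq> {..vec.dim X}"
      using D(1) by (auto intro!: vec.dim_subset)
    ultimately have "card D \<le> card {..vec.dim X}"
      by (intro card_inj_on_le) auto
    then show ?thesis by simp
  qed
  show ?thesis
    unfolding poset_rank_def
  proof (rule Max_eqI)
    show "vec.dim X \<in> {card C - 1 |C. C \<subseteq> {y \<in> span_lattice A. y \<le> X} \<and> Complete_Partial_Order.chain (\<le>) C}"
      using C by (intro CollectI exI[of _ C]) auto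
    show "k \<le> vec.dim X"
      if k: "k \<in> {card C - 1 |C. C \<subseteq> {y \<in> span_lattice A. y \<le> X} \<and> Complete_Partial_Order.chain (\<le>) C}" for k
    proof -
      obtain D where "k = card D - 1" "D \<subseteq> {y \<in> span_lattice A. y \<le> X}"
          "Complete_Partial_Order.chain (\<le>) D"
        using k by blast
      then show ?thesis
        using upper[of D] by linarith
    qed
    show "finite {card C - 1 |C. C \<subseteq> {y \<in> span_lattice A. y \<le> X} \<and> Complete_Partial_Order.chain (\<le>) C}"
      by (rule finite_subset[of _ "(\<lambda>C. card C - 1) ` UNIV"]) auto
  qed
qed

lemma zero_in_span_lattice: "{0} \<in> span_lattice A"
  by (auto simp: span_lattice_def intro!: exI[of _ "{}"])

lemma characteristic_poly_span_lattice:
  fixes A :: "('a::{field,finite} ^ 'n) set"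
  assumes "vec.span A = UNIV"
  shows "characteristic_poly (span_lattice A) =
    (\<Sum>X\<in>span_lattice A. monom (mobius (span_lattice A) {0} X) (CARD('n) - vec.dim X))"
proof -
  have "(LEAST Y. Y \<in> span_lattice A) = {0}"
    using zero_in_span_lattice
    by (intro Least_equality) (auto simp: span_lattice_def vec.span_zero)
  moreover have UNIV: "UNIV \<in> span_lattice A"
    using assms by (auto simp: span_lattice_def)
  then have "(GREATEST Y. Y \<in> span_lattice A) = UNIV"
    by (intro Greatest_equality) auto
  ultimately show ?thesis
    unfolding characteristic_poly_def
    by (auto simp: poset_rank_span_lattice UNIV card_cart_basis intro!: sum.cong)
qed

lemma degree_characteristic_poly_span_lattice:
  fixes A :: "('a::{field,finite} ^ 'n) set"
  assumes "vec.span A = UNIV"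
  shows "degree (characteristic_poly (span_lattice A)) \<le> CARD('n)"
  unfolding characteristic_poly_span_lattice[OF assms]
  by (intro degree_sum_le) (auto intro: order_trans[OF degree_monom_le])

text \<open>Only the bottom element has dimension 0, and its Moebius value is 1. Together with the
  degree bound this makes the polynomial monic of degree \<open>CARD('n)\<close>.\<close>

lemma coeff_characteristic_poly_span_lattice:
  fixes A :: "('a::{field,finite} ^ 'n) set"
  assumes "vec.span A = UNIV"
  shows "coeff (characteristic_poly (span_lattice A)) CARD('n) = 1"
proof -
  let ?L = "span_lattice A"
  have dim: "CARD('n) - vec.dim X = CARD('n) \<longleftrightarrow> X = {0}" if "X \<in> ?L" for X
  proof -
    have "0 \<in> X"
      using that by (auto simp: span_lattice_def vec.span_zero)
    \<comment> \<open>Positivity matters under truncated subtraction: it is what makes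
      \<open>CARD('n) - vec.dim X = CARD('n)\<close> force dimension 0.\<close>
    moreover have "CARD('n) > 0"
      by simp
    then have "CARD('n) - vec.dim X = CARD('n) \<longleftrightarrow> vec.dim X = 0"
      by linarith
    ultimately show ?thesis
      using vec.dim_eq_0[of X] by auto
  qed
  have "coeff (characteristic_poly ?L) CARD('n) =
      (\<Sum>X\<in>?L. if CARD('n) - vec.dim X = CARD('n) then mobius ?L {0} X else 0)"
    unfolding characteristic_poly_span_lattice[OF assms] by (simp add: coeff_sum)
  also have "\<dots> = (\<Sum>X\<in>?L. if X = {0} then mobius ?L {0} X else 0)"
    by (intro sum.cong refl) (simp only: dim)
  also have "\<dots> = 1"
    by (simp add: zero_in_span_lattice mobius.simps)
  finally show ?thesis .
qed

section \<open>The critical theorem\<close>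

definition homs_avoiding :: "('a::field ^ 'n) set \<Rightarrow> ('a ^ 'n) set \<Rightarrow> ('a ^ 'n \<Rightarrow> 'a ^ 'n) set" where
  "homs_avoiding A U = {f \<in> homs_into U. \<forall>x\<in>A. f x = 0 \<longrightarrow> x = 0}"

text \<open>
  The critical theorem of Crapo and Rota: \<open>card U ^ (n - dim X)\<close> counts the homomorphisms into
  \<open>U\<close> that vanish on \<open>X\<close>, so after exchanging sums the Moebius function is summed over the
  interval from \<open>0\<close> to the span of the part of \<open>A\<close> that lies in the kernel.
\<close>

theorem poly_characteristic_poly_span_lattice:
  fixes A U :: "('a::{field,finite} ^ 'n) set"
  assumes A: "vec.span A = UNIV" and U: "vec.subspace U"
  shows "poly (characteristic_poly (span_lattice A)) (int (card U)) = int (card (homs_avoiding A U))"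
proof -
  let ?L = "span_lattice A" and ?H = "homs_into U"
  let ?\<mu> = "mobius ?L {0}"
  have "poly (characteristic_poly ?L) (int (card U)) =
      (\<Sum>X\<in>?L. ?\<mu> X * int (card U ^ (CARD('n) - vec.dim X)))"
    by (simp add: characteristic_poly_span_lattice[OF A] poly_sum poly_monom)
  also have "\<dots> = (\<Sum>X\<in>?L. \<Sum>f | f \<in> ?H \<and> (\<forall>x\<in>X. f x = 0). ?\<mu> X)"
  proof (rule sum.cong)
    fix X assume "X \<in> ?L"
    then have "vec.subspace X"
      by (auto simp: span_lattice_def)
    then show "?\<mu> X * int (card U ^ (CARD('n) - vec.dim X)) = (\<Sum>f | f \<in> ?H \<and> (\<forall>x\<in>X. f x = 0). ?\<mu> X)"
      using U by (simp add: card_homs_into_vanishing[symmetric])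
  qed simp
  also have "\<dots> = (\<Sum>f\<in>?H. \<Sum>X | X \<in> ?L \<and> (\<forall>x\<in>X. f x = 0). ?\<mu> X)"
    by (rule sum.swap_restrict) simp_all
  also have "\<dots> = (\<Sum>f\<in>?H. if \<forall>x\<in>A. f x = 0 \<longrightarrow> x = 0 then 1 else 0)"
  proof (rule sum.cong)
    fix f assume "f \<in> ?H"
    then interpret f: Vector_Spaces.linear "(*s)" "(*s)" f
      by (rule homs_into_linear)
    \<comment> \<open>The kernel of \<open>f\<close> need not belong to the lattice;
      \<open>Y\<close> is the largest lattice element contained in it.\<close>
    define Y where "Y = vec.span {x \<in> A. f x = 0}"
    have Y: "Y \<in> ?L" "{0} \<le> Y"
      by (auto simp: Y_def span_lattice_def vec.span_zero)
    have "vec.subspace {x. f x = 0}"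
      by (rule f.subspace_kernel)
    then have ker: "f x = 0" if "x \<in> Y" for x
      using that vec.span_minimal[of "{x \<in> A. f x = 0}" "{x. f x = 0}"] by (auto simp: Y_def)
    have "(\<forall>x\<in>X. f x = 0) \<longleftrightarrow> {0} \<le> X \<and> X \<le> Y" if X: "X \<in> ?L" for X
    proof -
      obtain S where S: "S \<subseteq> A" "X = vec.span S"
        using X by (auto simp: span_lattice_def)
      have "X \<le> Y" if "\<forall>x\<in>X. f x = 0"
        unfolding Y_def S(2) using that S by (intro vec.span_mono) (auto intro: vec.span_base)
      then show ?thesis
        using ker S(2) by (auto simp: vec.span_zero)
    qed
    then have "{X \<in> ?L. \<forall>x\<in>X. f x = 0} = {X \<in> ?L. {0} \<le> X \<and> X \<le> Y}"
      by blast
    then have "(\<Sum>X | X \<in> ?L \<and> (\<forall>x\<in>X. f x = 0). ?\<mu> X) = (if {0} = Y then 1 else 0)"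
      using sum_mobius[OF _ zero_in_span_lattice Y] by simp
    moreover have "{0} = Y \<longleftrightarrow> (\<forall>x\<in>A. f x = 0 \<longrightarrow> x = 0)"
    proof
      assume "{0} = Y"
      then show "\<forall>x\<in>A. f x = 0 \<longrightarrow> x = 0"
        using vec.span_superset[of "{x \<in> A. f x = 0}"] by (auto simp: Y_def)
    next
      assume "\<forall>x\<in>A. f x = 0 \<longrightarrow> x = 0"
      then have "Y \<subseteq> vec.span {0}"
        unfolding Y_def by (intro vec.span_mono) auto
      then show "{0} = Y"
        using Y(2) by (auto simp: vec.span_singleton)
    qed
    ultimately show "(\<Sum>X | X \<in> ?L \<and> (\<forall>x\<in>X. f x = 0). ?\<mu> X)
        = (if \<forall>x\<in>A. f x = 0 \<longrightarrow> x = 0 then 1 else 0)"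
      by simp
  qed simp
  also have "\<dots> = int (card (homs_avoiding A U))"
    by (simp add: homs_avoiding_def sum.If_cases Int_def)
  finally show ?thesis .
qed

section \<open>Maps whose kernels avoid the vectors with a vanishing coordinate\<close>

lemma card_coordinate_hyperplane:
  "CARD('a) ^ (CARD('n) - 1) \<le> card {x :: 'a::{field,finite} ^ 'n. x $ i = 0}"
proof -
  let ?B = "cart_basis - {axis i 1} :: ('a ^ 'n) set"
  have "vec.independent ?B"
    using independent_cart_basis vec.independent_mono by blast
  moreover have "axis i 1 \<in> (cart_basis :: ('a ^ 'n) set)"
    by (auto simp: cart_basis_def)
  then have "card ?B = CARD('n) - 1"
    by (simp add: card_cart_basis card_Diff_subset finite_cart_basis)
  ultimately have "card (vec.span ?B) = CARD('a) ^ (CARD('n) - 1)"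
    using vec.card_span_independent[of ?B] by simp
  moreover have "vec.span ?B \<subseteq> {x. x $ i = 0}"
    by (rule vec.span_minimal) (auto simp: cart_basis_def axis_def vec.subspace_def)
  ultimately show ?thesis
    by (metis card_mono finite)
qed

text \<open>Pigeonhole: the hyperplane has more elements than \<open>U\<close>, so \<open>f\<close>
  identifies two of its points, and their difference is the required vector.\<close>

lemma kernel_meets_coordinate_hyperplane:
  fixes U :: "('a::{field,finite} ^ 'n) set"
  assumes "card U < CARD('a) ^ (CARD('n) - 1)" and f: "f \<in> homs_into U"
  obtains x where "x \<noteq> 0" "x $ i = 0" "f x = 0"
proof -
  interpret f: Vector_Spaces.linear "(*s)" "(*s)" f
    using f by (rule homs_into_linear)
  let ?H = "{x :: 'a ^ 'n. x $ i = 0}"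
  have "card (f ` ?H) \<le> card U"
    using f by (intro card_mono) (auto simp: homs_into_def)
  then have "card (f ` ?H) < card ?H"
    using assms(1) card_coordinate_hyperplane[of i, where ?'a = 'a] by linarith
  then have "\<not> inj_on f ?H"
    by (rule pigeonhole)
  then obtain x y where "x $ i = 0" "y $ i = 0" "f x = f y" "x \<noteq> y"
    by (auto simp: inj_on_def)
  then show ?thesis
    by (intro that[of "x - y"]) (auto simp: f.diff)
qed

text \<open>Through the critical theorem this supplies the \<open>n - 1\<close> roots of the
  characteristic polynomial.\<close>

lemma homs_avoiding_empty:
  fixes A U :: "('a::{field,finite} ^ 'n) set"
  assumes "\<And>x i. x $ i = 0 \<Longrightarrow> x \<in> A" and "card U < CARD('a) ^ (CARD('n) - 1)"
  shows "homs_avoiding A U = {}"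
  using assms kernel_meets_coordinate_hyperplane[OF assms(2)]
  unfolding homs_avoiding_def by blast

text \<open>Double counting of pairs \<open>(f, v)\<close> with \<open>v\<close> outside
  \<open>A\<close> and \<open>f v = 0\<close>. The kernel of each \<open>f\<close> is a line whose
  nonzero vectors all lie outside \<open>A\<close>; each \<open>v\<close> outside \<open>A\<close>
  is killed by exactly the maps whose kernel is its line.\<close>

lemma card_homs_avoiding:
  fixes A U :: "('a::{field,finite} ^ 'n) set"
  assumes coord: "\<And>x i. x $ i = 0 \<Longrightarrow> x \<in> A"
    and scale: "\<And>c x. c *s x \<in> A \<Longrightarrow> c \<noteq> 0 \<Longrightarrow> x \<in> A"
    and U: "vec.subspace U" and cardU: "card U = CARD('a) ^ (CARD('n) - 1)"
  shows "int (card (homs_avoiding A U)) * (int CARD('a) - 1) =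
    int (card (- A)) * (\<Prod>j<CARD('n) - 1. int (card U) - int (CARD('a) ^ j))"
proof -
  obtain i :: 'n where True by simp
  have nz: "v \<noteq> 0" if "v \<notin> A" for v
    using that coord[of v i] by auto
  have "card (UNIV :: 'a set) \<ge> 2"
    using card_mono[of UNIV "{0, 1 :: 'a}"] by simp
  then have "card U < CARD('a) ^ CARD('n)"
    unfolding cardU by (intro power_strict_increasing) auto
  then have big: "card U < CARD('a ^ 'n)"
    by (simp add: CARD_vec)
  \<comment> \<open>The target is smaller than the source, so no map is injective.\<close>
  have kernel: "\<exists>w. w \<noteq> 0 \<and> f w = 0" if f: "f \<in> homs_into U" for f
  proof -
    interpret f: Vector_Spaces.linear "(*s)" "(*s)" f
      using f by (rule homs_into_linear)
    have "card (range f) \<le> card U"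
      using f by (intro card_mono) (auto simp: homs_into_def)
    then have "\<not> inj f"
      using big by (intro pigeonhole) simp
    then obtain x y where "f x = f y" "x \<noteq> y"
      by (auto simp: inj_on_def)
    then show ?thesis
      by (intro exI[of _ "x - y"]) (auto simp: f.diff)
  qed
  have line: "{x. f x = 0} = vec.span {v}"
    if f: "f \<in> homs_avoiding A U" and v: "v \<noteq> 0" "f v = 0" for f v
  proof -
    interpret f: Vector_Spaces.linear "(*s)" "(*s)" f
      using f by (auto simp: homs_avoiding_def intro: homs_into_linear)
    have vi: "v $ i \<noteq> 0"
      using f v coord[of v i] by (auto simp: homs_avoiding_def)
    have "x \<in> vec.span {v}" if "f x = 0" for x
    proof -
      \<comment> \<open>Subtracting this multiple of \<open>v\<close> clears coordinate
        \<open>i\<close>. The result is a kernel vector in \<open>A\<close>, hence zero.\<close>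
      define y where "y = x - (x $ i / v $ i) *s v"
      have "y $ i = 0" "f y = 0"
        using vi v that by (simp_all add: y_def f.diff f.scale)
      then have "y = 0"
        using f coord[of y i] by (auto simp: homs_avoiding_def)
      then have "x = (x $ i / v $ i) *s v"
        by (simp add: y_def)
      then show ?thesis
        by (auto simp: vec.span_singleton)
    qed
    moreover have "f x = 0" if "x \<in> vec.span {v}" for x
      using that v by (auto simp: vec.span_singleton f.scale)
    ultimately show ?thesis by blast
  qed
  have "(\<Sum>f\<in>homs_avoiding A U. \<Sum>v | v \<in> - A \<and> f v = 0. 1 :: int) =
      (\<Sum>v\<in>- A. \<Sum>f | f \<in> homs_avoiding A U \<and> f v = 0. 1)"
    by (rule sum.swap_restrict) simp_all
  moreover have "int (card {v. v \<in> - A \<and> f v = 0}) = int CARD('a) - 1" if f: "f \<in> homs_avoiding A U" for f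
  proof -
    obtain w where w: "w \<noteq> 0" "f w = 0"
      using kernel f by (auto simp: homs_avoiding_def)
    have "{v. v \<in> - A \<and> f v = 0} = {x. f x = 0} - {0}"
      using f nz by (auto simp: homs_avoiding_def)
    also have "\<dots> = vec.span {w} - {0}"
      using line[OF f w] by simp
    finally show ?thesis
      using vec.card_span_independent[of "{w}"] w(1)
      by (simp add: card_Diff_subset vec.span_zero of_nat_diff)
  qed
  moreover have "int (card {f. f \<in> homs_avoiding A U \<and> f v = 0}) =
      (\<Prod>j<CARD('n) - 1. int (card U) - int (CARD('a) ^ j))" if v: "v \<in> - A" for v
  proof -
    \<comment> \<open>By \<open>scale\<close>, no nonzero multiple of \<open>v\<close> lies in
      \<open>A\<close>.\<close>
    have "f \<in> homs_avoiding A U" if f: "f \<in> homs_into U" "{x. f x = 0} = vec.span {v}" for f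
    proof -
      have "x = 0" if x: "x \<in> A" "f x = 0" for x
      proof -
        obtain c where "x = c *s v"
          using f(2) x by (auto simp: vec.span_singleton)
        then show "x = 0"
          using scale[of c v] v x by (cases "c = 0") auto
      qed
      then show ?thesis
        using f by (simp add: homs_avoiding_def)
    qed
    then have "{f. f \<in> homs_avoiding A U \<and> f v = 0} = {f \<in> homs_into U. {x. f x = 0} = vec.span {v}}"
      using line[of _ v] v nz[of v] vec.span_base[of v "{v}"] by (auto simp: homs_avoiding_def)
    then show ?thesis
      using card_homs_into_kernel_line[of v U] nz v U by simp
  qed
  ultimately show ?thesis
    by simp
qed

section \<open>Rank over the small field\<close>

text \<open>A basis chosen among the entries has \<open>CARD('n)\<close> elements only if the
  entries are pairwise distinct and all of them belong to the basis.\<close>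

lemma rk_less_iff:
  fixes v :: "'a::{field,finite} ^ 'n"
  assumes "field_embedding h"
  shows "rk h v < CARD('n) \<longleftrightarrow>
    \<not> (inj (($) v) \<and> \<not> module.dependent (ext_scale h) (range (($) v)))"
proof -
  interpret E: vector_space "ext_scale h"
    by (rule vector_space_ext_scale[OF assms])
  let ?R = "range (($) v)"
  have rk: "rk h v = E.dim ?R"
    by (simp add: rk_def)
  obtain B where B: "B \<subseteq> ?R" "E.independent B" "?R \<subseteq> E.span B" "card B = E.dim ?R"
    using E.basis_exists by blast
  show ?thesis
  proof (cases "inj (($) v) \<and> E.independent ?R")
    case True
    then show ?thesis
      by (simp add: rk E.dim_eq_card_independent card_image)
  next
    case False
    have "card B < CARD('n)"
    proof (rule ccontr)
      assume "\<not> card B < CARD('n)"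
      moreover have "card B \<le> card ?R" "card ?R \<le> CARD('n)"
        using B(1) by (auto intro: card_mono card_image_le)
      ultimately have "card ?R = CARD('n)" "card B = card ?R"
        by auto
      then have "inj (($) v)" "B = ?R"
        using card_subset_eq[OF _ B(1)] by (auto intro: eq_card_imp_inj_on)
      then show False
        using False B(2) by blast
    qed
    then show ?thesis
      using False B(4) rk by simp
  qed
qed

lemma rk_less_if_coord_zero:
  fixes v :: "'a::{field,finite} ^ 'n"
  assumes "field_embedding h" and "v $ i = 0"
  shows "rk h v < CARD('n)"
proof -
  interpret E: vector_space "ext_scale h"
    by (rule vector_space_ext_scale[OF assms(1)])
  have "0 \<in> range (($) v)"
    using assms(2) by (metis rangeI)
  then show ?thesis
    using rk_less_iff[OF assms(1)] E.dependent_zero by blast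
qed

text \<open>Multiplication by a nonzero \<open>c\<close> is injective and linear over the small
  field, so it preserves independence of the entries.\<close>

lemma rk_less_scale:
  fixes v :: "'a::{field,finite} ^ 'n"
  assumes h: "field_embedding h" and "c \<noteq> 0" and less: "rk h (c *s v) < CARD('n)"
  shows "rk h v < CARD('n)"
proof (rule ccontr)
  assume "\<not> rk h v < CARD('n)"
  then have v: "inj (($) v)" "\<not> module.dependent (ext_scale h) (range (($) v))"
    using rk_less_iff[OF h] by blast+
  interpret E: vector_space "ext_scale h"
    by (rule vector_space_ext_scale[OF h])
  have "Vector_Spaces.linear (ext_scale h) (ext_scale h) ((*) c)"
    by unfold_locales (auto simp: ext_scale_def algebra_simps)
  then interpret c: Vector_Spaces.linear "ext_scale h" "ext_scale h" "(*) c" .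
  have inj: "inj ((*) c)"
    using \<open>c \<noteq> 0\<close> by (auto simp: inj_on_def)
  have eq: "($) (c *s v) = (*) c \<circ> ($) v"
    by (auto simp: fun_eq_iff)
  have "E.independent ((*) c ` range (($) v))"
    using v(2) inj_on_subset[OF inj subset_UNIV] by (rule c.independent_injective_image)
  moreover have "inj (($) (c *s v))"
    unfolding eq using v(1) inj by (rule inj_compose[rotated])
  ultimately show False
    using less rk_less_iff[OF h, of "c *s v"] by (simp add: eq image_comp)
qed

text \<open>Vectors of full rank are the independent families of elements of the large field, viewed
  as a vector space over the small one and indexed by the coordinates.\<close>

lemma card_full_rank:
  fixes h :: "'k::{field,finite} \<Rightarrow> 'a::{field,finite}"
  assumes h: "field_embedding h"
  shows "int (card {v :: 'a ^ 'n. \<not> rk h v < CARD('n)}) =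
    (\<Prod>j<CARD('n). int CARD('a) - int (CARD('k) ^ j))"
proof -
  interpret E: vector_space "ext_scale h"
    by (rule vector_space_ext_scale[OF h])
  have "bij_betw ($) {v :: 'a ^ 'n. \<not> rk h v < CARD('n)} (E.indep_families UNIV UNIV)"
    by (rule bij_betw_byWitness[where f' = vec_lambda])
      (auto simp: E.indep_families_def rk_less_iff[OF h] vec_nth_inverse vec_lambda_inverse)
  then show ?thesis
    using E.card_indep_families[of "UNIV :: 'n set" UNIV] by (simp add: bij_betw_same_card)
qed

section \<open>Interpolation at the powers of the order of the large field\<close>

theorem theorem4p4:
  fixes q n m :: nat
    and h :: "'k::{field,finite} \<Rightarrow> 'a::{field,finite}"
  assumes "primepow q"
    and "CARD('k) = q"
    and "CARD('a) = q ^ m"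
    and "field_embedding h"
    and "CARD('n::finite) = n"
    and "n \<ge> 2" and "m \<ge> 2" and "n \<le> m"
  shows "characteristic_poly (rank_lattice h (n - 1) :: ('a ^ 'n) set set) =
    ([:0, 1:] - [:int q ^ ((n - 1) * m):] + [:\<Prod>s=1..n-1. int q ^ m - int q ^ s:])
      * (\<Prod>j=0..n-2. [:0, 1:] - [:int q ^ (m * j):])"
proof -
  define Q where "Q = CARD('a)"
  have Q: "Q = q ^ m" "Q \<ge> 2"
    using assms(3) card_mono[of UNIV "{0, 1 :: 'a}"] by (simp_all add: Q_def)
  define A :: "('a ^ 'n) set" where "A = {v. rk h v < CARD('n)}"
  define N where "N = (\<Prod>s=1..n-1. int q ^ m - int q ^ s)"
  define D where "D = (\<Prod>j<n-1. [:0, 1:] - [:int Q ^ j:])"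
  have L: "rank_lattice h (n - 1) = span_lattice A"
  proof -
    have "(\<forall>v\<in>S. rk h v \<le> n - 1) \<longleftrightarrow> S \<subseteq> A" for S
      using assms(5,6) by (auto simp: A_def)
    then show ?thesis
      by (simp add: rank_lattice_def span_lattice_def)
  qed
  have coord: "x \<in> A" if "x $ i = 0" for x i
    using rk_less_if_coord_zero[OF assms(4) that] by (simp add: A_def)
  have scale: "x \<in> A" if "c *s x \<in> A" "c \<noteq> 0" for c x
    using rk_less_scale[OF assms(4)] that by (simp add: A_def)
  have "cart_basis \<subseteq> A"
  proof
    fix x :: "'a ^ 'n" assume "x \<in> cart_basis"
    then obtain i where i: "x = axis i 1"
      by (auto simp: cart_basis_def)
    \<comment> \<open>Since \<open>n\<close> is at least 2, a unit vector vanishes at some other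
      coordinate and so lies in \<open>A\<close>.\<close>
    have "\<not> UNIV \<subseteq> {i}"
      using assms(5,6) card_mono[of "{i}" UNIV] by auto
    then obtain j where "j \<noteq> i" by blast
    then show "x \<in> A"
      using coord[of x j] by (simp add: i axis_def)
  qed
  then have A: "vec.span A = UNIV"
    using vec.span_mono[of cart_basis A] by auto
  \<comment> \<open>These subspaces realise the evaluation points of the critical theorem.\<close>
  have ex: "\<exists>U :: ('a ^ 'n) set. vec.subspace U \<and> card U = Q ^ k" if k: "k \<le> n" for k
  proof -
    obtain B where B: "B \<subseteq> (cart_basis :: ('a ^ 'n) set)" "card B = k" "finite B"
      using k assms(5)
      by (auto simp: card_cart_basis intro: obtain_subset_with_card_n[of k "cart_basis :: ('a ^ 'n) set"])
    have "vec.independent B"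
      using B(1) independent_cart_basis vec.independent_mono by blast
    then show ?thesis
      using vec.card_span_independent[of B] B by (intro exI[of _ "vec.span B"]) (auto simp: Q_def)
  qed
  have low: "poly (characteristic_poly (span_lattice A)) (int Q ^ k) = 0" if k: "k < n - 1" for k
  proof -
    obtain U :: "('a ^ 'n) set" where U: "vec.subspace U" "card U = Q ^ k"
      using ex[of k] k less_imp_le_nat[of k n] by auto
    have "card U < CARD('a) ^ (CARD('n) - 1)"
      using U k Q assms(5) by (auto simp: Q_def[symmetric] intro!: power_strict_increasing)
    then have "homs_avoiding A U = {}"
      using coord by (intro homs_avoiding_empty)
    then show ?thesis
      using poly_characteristic_poly_span_lattice[OF A U(1)] U(2) by simp
  qed
  have top: "poly (characteristic_poly (span_lattice A)) (int Q ^ (n - 1)) =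
      N * poly D (int Q ^ (n - 1))"
  proof -
    obtain U :: "('a ^ 'n) set" where U: "vec.subspace U" "card U = Q ^ (n - 1)"
      using ex[of "n - 1"] by auto
    have "- A = {v. \<not> rk h v < CARD('n)}"
      by (auto simp: A_def)
    then have "int (card (- A)) = (\<Prod>j<n. int Q - int q ^ j)"
      using card_full_rank[OF assms(4), where ?'n = 'n] assms(2,5) by (simp add: Q_def)
    also have "\<dots> = (int Q - 1) * N"
    proof -
      \<comment> \<open>The factor at index 0 is \<open>Q - 1\<close>, which cancels against the
        number of nonzero vectors on a line and leaves \<open>N\<close>.\<close>
      have "{..<n} = insert 0 {1..n-1}"
        using assms(6) by auto
      then show ?thesis
        by (simp add: N_def Q)
    qed
    finally have "int (card (homs_avoiding A U)) * (int Q - 1) = (N * poly D (int Q ^ (n - 1))) * (int Q - 1)"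
      using card_homs_avoiding[OF coord scale U(1)] U(2) assms(5)
      by (simp add: Q_def[symmetric] D_def poly_prod)
    then have "int (card (homs_avoiding A U)) = N * poly D (int Q ^ (n - 1))"
      using Q(2) by simp
    then show ?thesis
      using poly_characteristic_poly_span_lattice[OF A U(1)] U(2) by simp
  qed
  have D: "degree D = n - 1" "lead_coeff D = 1"
    unfolding D_def lead_coeff_prod by (simp_all add: degree_prod_eq_sum_degree)
  let ?R = "([:0, 1:] - [:int Q ^ (n - 1):] + [:N:]) * D"
  have "characteristic_poly (span_lattice A) = ?R"
  \<comment> \<open>With equal coefficients at degree \<open>n\<close> the difference has degree
    below \<open>n\<close>, so agreement at \<open>n\<close> distinct points suffices. At the last
    point the linear factor of \<open>?R\<close> equals \<open>N\<close>; at the others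
    \<open>D\<close> vanishes.\<close>
  proof (rule poly_eqI_degree_lead_coeff)
    show "degree (characteristic_poly (span_lattice A)) \<le> n"
      using degree_characteristic_poly_span_lattice[OF A] assms(5) by simp
    show "degree ?R \<le> n"
      using degree_mult_le[of "[:0, 1:] - [:int Q ^ (n - 1):] + [:N:]" D] D assms(6) by simp
    show "coeff (characteristic_poly (span_lattice A)) n = coeff ?R n"
      using coeff_characteristic_poly_span_lattice[OF A] assms(5,6) D
        coeff_mult_degree_sum[of "[:0, 1:] - [:int Q ^ (n - 1):] + [:N:]" D]
      by simp
    show "card ((\<lambda>j. int Q ^ j) ` {..<n}) \<ge> n"
      using Q(2) by (subst card_image) (auto simp: inj_on_def)
    fix x assume "x \<in> (\<lambda>j. int Q ^ j) ` {..<n}"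
    then obtain j where j: "x = int Q ^ j" "j < n"
      by auto
    show "poly (characteristic_poly (span_lattice A)) x = poly ?R x"
    proof (cases "j < n - 1")
      case True
      then have "poly D x = 0"
        by (auto simp: D_def poly_prod j)
      then show ?thesis
        using low[OF True] j by simp
    next
      case False
      then have "j = n - 1"
        using j by simp
      then show ?thesis
        using top j by (simp add: algebra_simps)
    qed
  qed
  moreover have "D = (\<Prod>j=0..n-2. [:0, 1:] - [:int q ^ (m * j):])"
  proof -
    \<comment> \<open>For \<open>n = 1\<close> truncated subtraction would make the right side
      \<open>{0}\<close> and the left side empty.\<close>
    have "{..<n-1} = {0..n-2}"
      using assms(6) by auto
    then show ?thesis
      by (simp add: D_def Q power_mult)
  qed
  moreover have "int Q ^ (n - 1) = int q ^ ((n - 1) * m)"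
    by (simp add: Q power_mult[symmetric] mult.commute)
  ultimately show ?thesis
    by (simp only: L N_def)
qed

end
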